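(* Let $n\ge 1$ and $u,w\in\mathfrak{W}_n$. If $\mathcal{W}(u)=\mathcal{W}(w)$, then $u\sim_{rid} w$.
   Context: Partitions are identified with Young diagrams in English notation; box $(i,j)$ lies in row $i$ (from the top) and column $j$ (from the left). For partitions $\lambda\subseteq\mu$, an increasing tableau of skew shape $\mu/\lambda$ is a filling of the boxes of $\mu/\lambda$ by positive integers that strictly increase left to right along rows and top to bottom along columns; $\mathrm{Inc}(\mu/\lambda)$ is the set of these. Let $\sigma_n=(n,n-1,\dots,1)$ and let $M_n\in\mathrm{Inc}(\sigma_n)$ be the minimal tableau, with entry $i+j-1$ in box $(i,j)$ ($M_0$ is empty). An inner corner of $\mu/\lambda$ is a box of $\lambda$ with no box of $\lambda$ immediately to its right or immediately below it. K-jeu de taquin: for $T\in\mathrm{Inc}(\mu/\lambda)$ and a set $B$ of inner corners, $\mathrm{jdt}_B(T)$ is obtained by placing a dot in each box of $B$ and then, for $i=1,2,\dots$ up to the largest entry of $T$: simultaneously, every dot that has a box containing $i$ immediately below it or immediately to its right is replaced by $i$, and every such box containing $i$ (i.e. with a dot immediately above it or immediately to its left) is replaced by a dot; finally the dots are deleted. For $T\in\mathrm{Inc}(\lambda)$ (straight shape) with largest entry $k$ and $U\in\mathrm{Inc}(\mu/\lambda)$, let $B_i$ be the set of boxes of $T$ containing $i$, put $U_k=U$, $U_{i-1}=\mathrm{jdt}_{B_i}(U_i)$ for $i=k,\dots,1$, and $\mathrm{jdt}_T(U)=U_0$. $\mathfrak{W}_n$ is the set of words of length $n$ with positive integer letters;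 a word $w\in\mathfrak{W}_n$ is identified with the increasing tableau of shape $\sigma_n/\sigma_{n-1}$ having $w_i$ in box $(n+1-i,i)$. Define $\mathcal{W}(w)=\mathrm{jdt}_{M_{n-1}}(w)$ (this is the first component of the K-infusion of $(M_{n-1},w)$). For a word $x$, $\mathrm{lis}(x)$ and $\mathrm{lds}(x)$ are the lengths of a longest strictly increasing, resp. strictly decreasing, subsequence of $x$. Words $u,w$ satisfy $u\sim_{rid} w$ if for every integer interval $[a,b]$, letting $u',w'$ be obtained from $u,w$ by deleting all letters not in $[a,b]$, we have $\mathrm{lis}(u')=\mathrm{lis}(w')$ and $\mathrm{lds}(u')=\mathrm{lds}(w')$. *)

theory Defs
  imports Main "HOL-Library.Sublist"
begin

section \<open>Young diagrams and increasing tableaux\<close>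

text \<open>
  A box is a pair (row, column), both counted from 1, in English notation. A partition is identified
  with its Young diagram, and a tableau is a partial map whose domain is its skew shape.
\<close>

type_synonym box = "nat \<times> nat"
type_synonym tableau = "box \<Rightarrow> nat option"

fun right_of :: "box \<Rightarrow> box" where
  "right_of (i, j) = (i, Suc j)"

fun below :: "box \<Rightarrow> box" where
  "below (i, j) = (Suc i, j)"

definition young_diagram :: "box set \<Rightarrow> bool" where
  "young_diagram lam \<longleftrightarrow> finite lam \<and> (\<forall>(i, j) \<in> lam. 1 \<le> i \<and> 1 \<le> j) \<and>
     (\<forall>(i, j) \<in> lam. \<forall>i' j'. 1 \<le> i' \<and> i' \<le> i \<and> 1 \<le> j' \<and> j' \<le> j \<longrightarrow> (i', j') \<in> lam)"

text \<open>The increasing tableaux of skew shape \<open>mu / lam\<close>.\<close>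

definition Inc :: "box set \<Rightarrow> box set \<Rightarrow> tableau set" where
  "Inc mu lam = {T. young_diagram mu \<and> young_diagram lam \<and> lam \<subseteq> mu \<and> dom T = mu - lam \<and>
     (\<forall>x \<in> ran T. 0 < x) \<and>
     (\<forall>i j j' x y. j < j' \<and> T (i, j) = Some x \<and> T (i, j') = Some y \<longrightarrow> x < y) \<and>
     (\<forall>i i' j x y. i < i' \<and> T (i, j) = Some x \<and> T (i', j) = Some y \<longrightarrow> x < y)}"

definition inner_corners :: "box set \<Rightarrow> box set" where
  "inner_corners lam = {b \<in> lam. right_of b \<notin> lam \<and> below b \<notin> lam}"

text \<open>The 0 only matters for the empty tableau, for which there is no entry to process.\<close>

definition largest_entry :: "tableau \<Rightarrow> nat" where
  "largest_entry T = Max (insert 0 (ran T))"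


section \<open>K-jeu de taquin\<close>

datatype entry = Dot | Num nat

type_synonym dotted = "box \<Rightarrow> entry option"

definition place_dots :: "box set \<Rightarrow> tableau \<Rightarrow> dotted" where
  "place_dots B T = (\<lambda>b. if b \<in> B then Some Dot else map_option Num (T b))"

definition delete_dots :: "dotted \<Rightarrow> tableau" where
  "delete_dots D = (\<lambda>b. case D b of Some (Num x) \<Rightarrow> Some x | _ \<Rightarrow> None)"

text \<open>
  One simultaneous exchange of the dots with the adjacent entries \<open>i\<close>; all conditions refer to
  the filling \<open>D\<close> before the exchange.
\<close>

definition switch :: "nat \<Rightarrow> dotted \<Rightarrow> dotted" where
  "switch i D = (\<lambda>b.
     if D b = Some Dot \<and> (D (below b) = Some (Num i) \<or> D (right_of b) = Some (Num i))
       then Some (Num i)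
     else if D b = Some (Num i) \<and> (\<exists>c. D c = Some Dot \<and> (below c = b \<or> right_of c = b))
       then Some Dot
     else D b)"

definition jdt_set :: "box set \<Rightarrow> tableau \<Rightarrow> tableau" where
  "jdt_set B T = delete_dots (fold switch [1..<Suc (largest_entry T)] (place_dots B T))"

text \<open>Slides along the boxes of \<open>T\<close> containing \<open>k\<close>, then \<open>k - 1\<close>, down to 1.\<close>

definition jdt_tableau :: "tableau \<Rightarrow> tableau \<Rightarrow> tableau" where
  "jdt_tableau T U =
     fold (\<lambda>i. jdt_set {b. T b = Some i}) (rev [1..<Suc (largest_entry T)]) U"


section \<open>Staircases, minimal tableaux and words\<close>

text \<open>The staircase partition \<open>(n, n - 1, \<dots>, 1)\<close>.\<close>

definition staircase :: "nat \<Rightarrow> box set" where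
  "staircase n = {(i, j). 1 \<le> i \<and> 1 \<le> j \<and> i + j \<le> Suc n}"

definition minimal_tableau :: "nat \<Rightarrow> tableau" where
  "minimal_tableau n = (\<lambda>(i, j). if (i, j) \<in> staircase n then Some (i + j - 1) else None)"

definition words :: "nat \<Rightarrow> nat list set" where
  "words n = {w. length w = n \<and> (\<forall>x \<in> set w. 0 < x)}"

text \<open>
  With \<open>n = length w\<close>, the letter number \<open>j\<close> of \<open>w\<close> is put in the box \<open>(n + 1 - j, j)\<close> of the
  antidiagonal; list positions count from 0.
\<close>

definition word_tableau :: "nat list \<Rightarrow> tableau" where
  "word_tableau w = (\<lambda>(i, j).
     if (i, j) \<in> staircase (length w) - staircase (length w - 1) then Some (w ! (j - 1)) else None)"

definition rect_word :: "nat list \<Rightarrow> tableau" where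
  "rect_word w = jdt_tableau (minimal_tableau (length w - 1)) (word_tableau w)"


section \<open>Longest increasing and decreasing subsequences\<close>

definition lis :: "nat list \<Rightarrow> nat" where
  "lis x = Max {length s | s. subseq s x \<and> sorted_wrt (<) s}"

definition lds :: "nat list \<Rightarrow> nat" where
  "lds x = Max {length s | s. subseq s x \<and> sorted_wrt (>) s}"

definition rid_equiv :: "nat list \<Rightarrow> nat list \<Rightarrow> bool" (infix "\<sim>\<^sub>r\<^sub>i\<^sub>d" 50) where
  "u \<sim>\<^sub>r\<^sub>i\<^sub>d w \<longleftrightarrow> (\<forall>a b :: int.
     let u' = filter (\<lambda>x. int x \<in> {a..b}) u; w' = filter (\<lambda>x. int x \<in> {a..b}) w
     in lis u' = lis w' \<and> lds u' = lds w')"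


section \<open>The ingredients of the rectification are of the required kind\<close>

lemma young_diagram_staircase: "young_diagram (staircase n)"
proof -
  have "finite (staircase n)"
    by (rule finite_subset[of _ "{..Suc n} \<times> {..Suc n}"]) (auto simp: staircase_def)
  then show ?thesis
    by (auto simp: young_diagram_def staircase_def)
qed

lemma minimal_tableau_in_Inc: "minimal_tableau n \<in> Inc (staircase n) {}"
proof -
  have "young_diagram {}"
    by (simp add: young_diagram_def)
  then show ?thesis
    using young_diagram_staircase[of n]
    by (auto simp: Inc_def minimal_tableau_def ran_def dom_def staircase_def split: if_splits)
qed

lemma word_tableau_in_Inc:
  assumes "n \<ge> 1" and "w \<in> words n"
  shows "word_tableau w \<in> Inc (staircase n) (staircase (n - 1))"
proof -
  have len: "length w = n" and pos: "\<And>x. x \<in> set w \<Longrightarrow> 0 < x"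
    using assms(2) by (auto simp: words_def)
  have "staircase (n - 1) \<subseteq> staircase n"
    by (auto simp: staircase_def)
  moreover have "0 < x" if "x \<in> ran (word_tableau w)" for x
  proof -
    from that obtain i j where
      "(i, j) \<in> staircase n - staircase (n - 1)" "x = w ! (j - 1)"
      by (auto simp: ran_def word_tableau_def len split: if_splits)
    moreover from this(1) have "j - 1 < n"
      by (auto simp: staircase_def)
    ultimately show ?thesis
      using pos len by simp
  qed
  moreover have "dom (word_tableau w) = staircase n - staircase (n - 1)"
    by (auto simp: word_tableau_def len split: if_splits)
  moreover have "i + j = Suc n" if "word_tableau w (i, j) = Some x" for i j x
    using that assms(1) unfolding word_tableau_def len
    by (simp add: staircase_def split: if_splits)
  then have "\<not> (word_tableau w (i, j) = Some x \<and> word_tableau w (i, j') = Some y)" if "j < j'" for i j j' x y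
    using that by (metis add_left_cancel less_irrefl)
  moreover have "\<not> (word_tableau w (i, j) = Some x \<and> word_tableau w (i', j) = Some y)" if "i < i'" for i i' j x y
    using that \<open>\<And>i j x. word_tableau w (i, j) = Some x \<Longrightarrow> i + j = Suc n\<close>
    by (metis add_right_cancel less_irrefl)
  ultimately show ?thesis
    unfolding Inc_def mem_Collect_eq using young_diagram_staircase by blast
qed

lemma minimal_tableau_largest_inner_corners:
  assumes "n \<ge> 1"
  shows "{b. minimal_tableau n b = Some n} = inner_corners (staircase n)"
  using assms
  by (auto simp: inner_corners_def minimal_tableau_def staircase_def split: if_splits)

end

theory Submission
  imports Defs
begin

text \<open>
  Record each entry of a tableau only by its column and its value. Every single exchange of dots and
  entries in K-jeu de taquin preserves the lengths of chains that strictly increase both in column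
  and in value, with values in a fixed interval. In the antidiagonal tableau of a word these chains
  are the increasing subsequences, so the rectification determines the first statistic for all
  intervals. Reversing the word transposes its rectification, which gives the second one.
\<close>

text \<open>An entry that moves up stays in its column, so only moves to the left can disturb a
  chain. The obstacle is that such a move can bring the entry into a column which the chain already
  uses, and undoing it can do the same from the other side. The chain then cannot follow the entry;
  it has to take the entry of a third box, which exists because the shape has no holes and lies in
  the right range because the filling is strictly increasing. Its value is bounded on both sides by
  values of the chain, so the chain stays within the prescribed interval. This argument takes place
  in the middle of a slide, while dots are present. The dots therefore get a rank of their own,
  chosen so that the dotted filling is strictly increasing at every stage. Simultaneous exchanges
  may also duplicate or merge copies of an entry; this is harmless for a set of pairs of column and
  value, since a chain never uses two copies of one value.\<close>

section \<open>Dotted tableaux\<close>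

text \<open>Once the entries up to \<open>t\<close> have been processed, a dot ranks strictly between
  \<open>t\<close> and \<open>t + 1\<close>; the factor 2 makes room for it.\<close>

fun entry_rank :: "nat \<Rightarrow> entry \<Rightarrow> nat" where
  "entry_rank t Dot = 2 * t + 1"
| "entry_rank t (Num x) = 2 * x"

definition convex_boxes :: "box set \<Rightarrow> bool" where
  "convex_boxes S \<longleftrightarrow> (\<forall>r c r' c' r'' c''. (r, c) \<in> S \<longrightarrow> (r'', c'') \<in> S \<longrightarrow>
     r \<le> r' \<longrightarrow> r' \<le> r'' \<longrightarrow> c \<le> c' \<longrightarrow> c' \<le> c'' \<longrightarrow> (r', c') \<in> S)"

text \<open>All dots have the same rank, so strictness makes them an antichain. Comparing all weakly
  southeast boxes, not just those in one row or column, and demanding convexity gives access to any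
  box of the rectangle spanned by two boxes. Exchanges keep the domain, so convexity survives a
  slide.\<close>

definition dotted_increasing :: "nat \<Rightarrow> dotted \<Rightarrow> bool" where
  "dotted_increasing t D \<longleftrightarrow> convex_boxes (dom D) \<and>
     (\<forall>r c r' c' e e'. D (r, c) = Some e \<longrightarrow> D (r', c') = Some e' \<longrightarrow>
        r \<le> r' \<longrightarrow> c \<le> c' \<longrightarrow> (r, c) \<noteq> (r', c') \<longrightarrow> entry_rank t e < entry_rank t e')"

lemma convex_boxesD:
  "convex_boxes S \<Longrightarrow> (r, c) \<in> S \<Longrightarrow> (r'', c'') \<in> S \<Longrightarrow>
     r \<le> r' \<Longrightarrow> r' \<le> r'' \<Longrightarrow> c \<le> c' \<Longrightarrow> c' \<le> c'' \<Longrightarrow> (r', c') \<in> S"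
  unfolding convex_boxes_def by blast

lemma dotted_increasing_rank:
  "dotted_increasing t D \<Longrightarrow> D (r, c) = Some e \<Longrightarrow> D (r', c') = Some e' \<Longrightarrow>
     r \<le> r' \<Longrightarrow> c \<le> c' \<Longrightarrow> (r, c) \<noteq> (r', c') \<Longrightarrow> entry_rank t e < entry_rank t e'"
  unfolding dotted_increasing_def by blast

lemma dotted_increasing_between:
  assumes "dotted_increasing t D" "D (r, c) = Some e" "D (r'', c'') = Some e''"
    and "r \<le> r'" "r' \<le> r''" "c \<le> c'" "c' \<le> c''"
  obtains e' where "D (r', c') = Some e'"
  using convex_boxesD[of "dom D" r c r'' c'' r' c'] assms
  unfolding dotted_increasing_def by blast

section \<open>A single exchange\<close>

lemma switch_eq:
  "switch i D (r, c) =
     (if D (r, c) = Some Dot \<and> (D (Suc r, c) = Some (Num i) \<or> D (r, Suc c) = Some (Num i))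
        then Some (Num i)
      else if D (r, c) = Some (Num i) \<and>
        ((\<exists>r'. r = Suc r' \<and> D (r', c) = Some Dot) \<or> (\<exists>c'. c = Suc c' \<and> D (r, c') = Some Dot))
        then Some Dot
      else D (r, c))"
proof -
  have "(\<exists>b. D b = Some Dot \<and> (below b = (r, c) \<or> right_of b = (r, c))) \<longleftrightarrow>
        (\<exists>r'. r = Suc r' \<and> D (r', c) = Some Dot) \<or> (\<exists>c'. c = Suc c' \<and> D (r, c') = Some Dot)"
    by auto
  then show ?thesis by (simp add: switch_def)
qed

lemma dom_switch [simp]: "dom (switch i D) = dom D"
  unfolding dom_def by (auto simp: switch_eq split: if_splits)

lemma switch_Num_other:
  "x \<noteq> i \<Longrightarrow> switch i D b = Some (Num x) \<longleftrightarrow> D b = Some (Num x)"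
  by (auto simp: switch_def)

lemma switch_entry_cases:
  assumes "D b = Some e" and "switch i D b = Some f"
  shows "e \<in> {Dot, Num i} \<and> f \<in> {Dot, Num i} \<or> e \<notin> {Dot, Num i} \<and> f = e"
  using assms by (cases "e = Dot"; cases "e = Num i") (auto simp: switch_def split: if_splits)

lemma delete_dots_eq_Some [simp]: "delete_dots D b = Some x \<longleftrightarrow> D b = Some (Num x)"
  by (simp add: delete_dots_def split: option.splits entry.splits)

text \<open>No rank lies between those of a dot and of the entry to be processed next.\<close>

lemma dot_Num_adjacent:
  assumes D: "dotted_increasing t D"
    and dot: "D (r, c) = Some Dot" and num: "D (r', c') = Some (Num (Suc t))"
    and le: "r \<le> r'" "c \<le> c'"
  shows "(r', c') = (Suc r, c) \<or> (r', c') = (r, Suc c)"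
proof (rule ccontr)
  assume not_adjacent: "\<not> ?thesis"
  have "\<exists>p q. r \<le> p \<and> p \<le> r' \<and> c \<le> q \<and> q \<le> c' \<and> (p, q) \<noteq> (r, c) \<and> (p, q) \<noteq> (r', c')"
  proof (cases "r = r'")
    case True
    then have "c \<noteq> c'" using dot num by auto
    then have "r \<le> r \<and> r \<le> r' \<and> c \<le> Suc c \<and> Suc c \<le> c' \<and> (r, Suc c) \<noteq> (r, c) \<and> (r, Suc c) \<noteq> (r', c')"
      using le True not_adjacent by auto
    then show ?thesis by blast
  next
    case False
    then have "r \<le> Suc r \<and> Suc r \<le> r' \<and> c \<le> c \<and> c \<le> c' \<and> (Suc r, c) \<noteq> (r, c) \<and> (Suc r, c) \<noteq> (r', c')"
      using le not_adjacent by auto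
    then show ?thesis by blast
  qed
  then obtain p q where pq: "r \<le> p" "p \<le> r'" "c \<le> q" "q \<le> c'" "(p, q) \<noteq> (r, c)" "(p, q) \<noteq> (r', c')"
    by blast
  obtain e where e: "D (p, q) = Some e"
    using dotted_increasing_between[OF D dot num] pq by blast
  have "entry_rank t Dot < entry_rank t e" "entry_rank t e < entry_rank t (Num (Suc t))"
    using dotted_increasing_rank[OF D dot e] dotted_increasing_rank[OF D e num] pq by auto
  then show False by simp
qed

text \<open>Dots and entries \<open>Suc t\<close> have ranks 2t+1 and 2t+2 before the exchange, 2t+3
  and 2t+2 after it; every other rank is at most 2t or at least 2t+4 and does not change. So only a
  dot weakly northwest of a \<open>Suc t\<close> could cause a violation, and these two boxes are
  adjacent and both get exchanged.\<close>

lemma dotted_increasing_switch: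
  assumes D: "dotted_increasing t D"
  shows "dotted_increasing (Suc t) (switch (Suc t) D)"
  unfolding dotted_increasing_def
proof (intro conjI allI impI)
  show "convex_boxes (dom (switch (Suc t) D))"
    using D by (simp add: dotted_increasing_def)
next
  fix r c r' c' f f'
  assume f: "switch (Suc t) D (r, c) = Some f" and f': "switch (Suc t) D (r', c') = Some f'"
    and le: "r \<le> r'" "c \<le> c'" and ne: "(r, c) \<noteq> (r', c')"
  have "(r, c) \<in> dom D" "(r', c') \<in> dom D"
    using f f' dom_switch by (metis domI)+
  then obtain e e' where e: "D (r, c) = Some e" and e': "D (r', c') = Some e'"
    by blast
  have rank: "entry_rank t e < entry_rank t e'"
    using dotted_increasing_rank[OF D e e' le ne] .
  have exchanged: "f = Num (Suc t) \<and> f' = Dot" if "e = Dot" "e' = Num (Suc t)"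
    using dot_Num_adjacent[OF D _ _ le] that e e' f f' by (auto simp: switch_eq)
  have "e \<in> {Dot, Num (Suc t)} \<and> f \<in> {Dot, Num (Suc t)} \<or> e \<notin> {Dot, Num (Suc t)} \<and> f = e"
    "e' \<in> {Dot, Num (Suc t)} \<and> f' \<in> {Dot, Num (Suc t)} \<or> e' \<notin> {Dot, Num (Suc t)} \<and> f' = e'"
    using switch_entry_cases[of D] e f e' f' by blast+
  then show "entry_rank (Suc t) f < entry_rank (Suc t) f'"
    using rank exchanged
    by (cases e; cases e'; cases f; cases f') (auto, presburger+)
qed

section \<open>Increasing chains of columns and entries\<close>

definition column_points :: "tableau \<Rightarrow> (nat \<times> nat) set" where
  "column_points T = {(c, x). \<exists>r. T (r, c) = Some x}"

definition increasing_chain :: "(nat \<times> nat) list \<Rightarrow> bool" where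
  "increasing_chain = sorted_wrt (\<lambda>p q. fst p < fst q \<and> snd p < snd q)"

text \<open>Keeping the whole set of lengths rather than its maximum lets invariance be proved by
  two inclusions, without any finiteness argument.\<close>

definition chain_lengths :: "int set \<Rightarrow> (nat \<times> nat) set \<Rightarrow> nat set" where
  "chain_lengths A S = {length ps | ps. increasing_chain ps \<and> set ps \<subseteq> S \<and> (\<forall>(c, x) \<in> set ps. int x \<in> A)}"

text \<open>A chain contains at most one point with entry \<open>i\<close>; replacing that point suffices.\<close>

lemma chain_lengths_mono_replace:
  assumes other: "\<And>c x. (c, x) \<in> S \<Longrightarrow> x \<noteq> i \<Longrightarrow> (c, x) \<in> S'"
    and replace: "\<And>c ps qs. (c, i) \<in> S \<Longrightarrow> increasing_chain (ps @ (c, i) # qs) \<Longrightarrow>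
      set ps \<subseteq> S \<Longrightarrow> set qs \<subseteq> S \<Longrightarrow>
      \<exists>p \<in> S'. increasing_chain (ps @ p # qs) \<and>
        (\<exists>y \<in> insert i (snd ` set ps). y \<le> snd p) \<and> (\<exists>y \<in> insert i (snd ` set qs). snd p \<le> y)"
  shows "chain_lengths {a..b} S \<subseteq> chain_lengths {a..b} S'"
proof
  fix k assume "k \<in> chain_lengths {a..b} S"
  then obtain ps where ps: "k = length ps" "increasing_chain ps" "set ps \<subseteq> S"
    "\<forall>(c, x) \<in> set ps. int x \<in> {a..b}"
    unfolding chain_lengths_def by blast
  show "k \<in> chain_lengths {a..b} S'"
  proof (cases "\<exists>c. (c, i) \<in> set ps")
    case False
    have "set ps \<subseteq> S'"
    proof
      fix q assume "q \<in> set ps"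
      then have "(fst q, snd q) \<in> set ps" by simp
      then have "(fst q, snd q) \<in> S" "snd q \<noteq> i"
        using ps(3) False by blast+
      then show "q \<in> S'" using other[of "fst q" "snd q"] by simp
    qed
    then show ?thesis using ps unfolding chain_lengths_def by blast
  next
    case True
    then obtain c us vs where split: "ps = us @ (c, i) # vs"
      by (meson split_list)
    have us: "set us \<subseteq> S" and vs: "set vs \<subseteq> S" and ci: "(c, i) \<in> S"
      and chain: "increasing_chain (us @ (c, i) # vs)"
      using ps(2,3) by (simp_all add: split)
    have "\<exists>p \<in> S'. increasing_chain (us @ p # vs) \<and>
        (\<exists>y \<in> insert i (snd ` set us). y \<le> snd p) \<and> (\<exists>y \<in> insert i (snd ` set vs). snd p \<le> y)"
      using replace[OF ci chain us vs] .
    then obtain p y y' where p: "p \<in> S'" "increasing_chain (us @ p # vs)"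
      and y: "y \<in> insert i (snd ` set us)" "y \<le> snd p"
      and y': "y' \<in> insert i (snd ` set vs)" "snd p \<le> y'"
      by blast
    \<comment> \<open>The values \<open>y\<close> and \<open>y'\<close> occur in the old chain and
      enclose the new value. This is where the argument uses that the admissible values form an
      interval.\<close>
    have in_interval: "\<forall>x \<in> snd ` set ps. int x \<in> {a..b}"
      using ps(4) by (simp add: case_prod_unfold)
    have "y \<in> snd ` set ps" "y' \<in> snd ` set ps"
      using y(1) y'(1) unfolding split by auto
    then have "int y \<in> {a..b}" "int y' \<in> {a..b}"
      using in_interval by blast+
    then have p_interval: "int (snd p) \<in> {a..b}"
      using y(2) y'(2) by simp
    have "q \<in> S'" if "q \<in> set us \<union> set vs" for q
    proof -
      have "snd q \<noteq> i" "q \<in> S"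
        using that chain us vs unfolding increasing_chain_def sorted_wrt_append by auto
      then show ?thesis using other[of "fst q" "snd q"] by simp
    qed
    then have "set (us @ p # vs) \<subseteq> S'"
      using p(1) by auto
    moreover have "\<forall>(c, x) \<in> set (us @ p # vs). int x \<in> {a..b}"
      using p_interval ps(4) by (simp add: split case_prod_unfold)
    moreover have "k = length (us @ p # vs)"
      using ps(1) split by simp
    ultimately show ?thesis
      using p(2) unfolding chain_lengths_def by blast
  qed
qed

lemma increasing_chain_comparable:
  assumes "increasing_chain ps" and "p \<in> set ps" and "q \<in> set ps"
  shows "p = q \<or> fst p < fst q \<and> snd p < snd q \<or> fst q < fst p \<and> snd q < snd p"
  using assms unfolding increasing_chain_def by (induction ps) auto

lemma increasing_chain_replace:
  assumes "increasing_chain (ps @ p # qs)"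
    and "\<And>q. q \<in> set ps \<Longrightarrow> fst q < fst p' \<and> snd q < snd p'"
    and "\<And>q. q \<in> set qs \<Longrightarrow> fst p' < fst q \<and> snd p' < snd q"
  shows "increasing_chain (ps @ p' # qs)"
  using assms by (auto simp: increasing_chain_def sorted_wrt_append)

lemma increasing_chain_middle:
  assumes "increasing_chain (ps @ p # qs)"
  shows "q \<in> set ps \<Longrightarrow> fst q < fst p \<and> snd q < snd p"
    and "q \<in> set qs \<Longrightarrow> fst p < fst q \<and> snd p < snd q"
  using assms by (auto simp: increasing_chain_def sorted_wrt_append)

text \<open>If the entry \<open>i = t + 1\<close> moves from column \<open>c\<close> to column \<open>c - 1\<close>, where the chain already has
  an entry \<open>z\<close>, then the box to the right of \<open>z\<close> has an entry strictly between \<open>z\<close> and \<open>i\<close>,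
  which takes the place of \<open>i\<close> in the chain.\<close>

lemma chain_lengths_switch_subset:
  assumes D: "dotted_increasing t D"
  shows "chain_lengths {a..b} (column_points (delete_dots D)) \<subseteq>
    chain_lengths {a..b} (column_points (delete_dots (switch (Suc t) D)))" (is "chain_lengths _ ?S \<subseteq> chain_lengths _ ?S'")
proof (rule chain_lengths_mono_replace[where i = "Suc t"])
  show "(c, x) \<in> ?S'" if "(c, x) \<in> ?S" "x \<noteq> Suc t" for c x
    using that by (simp add: column_points_def switch_Num_other)
next
  fix c ps qs
  assume "(c, Suc t) \<in> ?S" and chain: "increasing_chain (ps @ (c, Suc t) # qs)"
    and ps: "set ps \<subseteq> ?S"
  then obtain r where r: "D (r, c) = Some (Num (Suc t))"
    by (auto simp: column_points_def)
  note middle = increasing_chain_middle[OF chain]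
  show "\<exists>p \<in> ?S'. increasing_chain (ps @ p # qs) \<and>
      (\<exists>y \<in> insert (Suc t) (snd ` set ps). y \<le> snd p) \<and>
      (\<exists>y \<in> insert (Suc t) (snd ` set qs). snd p \<le> y)"
  proof (cases "(c, Suc t) \<in> ?S'")
    case True
    then show ?thesis using chain by (intro bexI[of _ "(c, Suc t)"]) auto
  next
    case False
    then have no: "switch (Suc t) D (q, c) \<noteq> Some (Num (Suc t))" for q
      by (auto simp: column_points_def)
    \<comment> \<open>A dot above would turn into \<open>Suc t\<close> and column \<open>c\<close>
      would keep this entry. So the dot responsible for the loss is on the left.\<close>
    have no_dot_above: "D (q, c) \<noteq> Some Dot" if "r = Suc q" for q
      using no[of q] r that by (auto simp: switch_eq)
    then obtain c' where c': "c = Suc c'" "D (r, c') = Some Dot"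
      using no[of r] r by (auto simp: switch_eq split: if_splits)
    show ?thesis
    proof (cases "\<exists>z. (c', z) \<in> set ps")
      case True
      then obtain z where z: "(c', z) \<in> set ps" by blast
      then obtain r' where r': "D (r', c') = Some (Num z)"
        using ps by (auto simp: column_points_def)
      have "z < Suc t" using middle(1)[OF z] by simp
      \<comment> \<open>At or below row \<open>r\<close>, column \<open>c'\<close> only has ranks at
        least that of the dot, which exceeds the rank of \<open>z\<close>. Hence \<open>z\<close>
        lies higher up, and the box (\<open>r'\<close>, \<open>c\<close>) is a corner of the
        rectangle between \<open>z\<close> and \<open>Suc t\<close>.\<close>
      have "\<not> r \<le> r'"
        using dotted_increasing_rank[OF D c'(2) r'] \<open>z < Suc t\<close> r' c'(2)
        by (cases "r = r'") auto
      then have "r' < r" by simp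
      then obtain e where e: "D (r', c) = Some e"
        using dotted_increasing_between[OF D r' r, of r' c] c'(1) by auto
      have "e \<noteq> Dot"
        using dot_Num_adjacent[OF D _ r, of r' c] e \<open>r' < r\<close> no_dot_above by auto
      then obtain z' where z': "e = Num z'" by (cases e) auto
      have "z < z'" "z' < Suc t"
        using dotted_increasing_rank[OF D r' e] dotted_increasing_rank[OF D e r] \<open>r' < r\<close> c'(1) z'
        by auto
      have "(c, z') \<in> ?S'"
        using e z' \<open>z' < Suc t\<close> by (auto simp: column_points_def switch_Num_other)
      moreover have "increasing_chain (ps @ (c, z') # qs)"
      proof (rule increasing_chain_replace[OF chain])
        fix q assume q: "q \<in> set ps"
        \<comment> \<open>No column lies strictly between \<open>c'\<close> and \<open>c\<close>, so
          (\<open>c'\<close>, \<open>z\<close>) is the last point of \<open>ps\<close> and it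
          suffices to exceed \<open>z\<close>.\<close>
        have "increasing_chain ps"
          using chain by (simp add: increasing_chain_def sorted_wrt_append)
        then show "fst q < fst (c, z') \<and> snd q < snd (c, z')"
          using increasing_chain_comparable[of ps q "(c', z)"] q z middle(1)[OF q] c'(1) \<open>z < z'\<close>
          by auto
      next
        fix q assume "q \<in> set qs"
        then show "fst (c, z') < fst q \<and> snd (c, z') < snd q"
          using middle(2)[of q] \<open>z' < Suc t\<close> by auto
      qed
      moreover have "\<exists>y \<in> insert (Suc t) (snd ` set ps). y \<le> snd (c, z')"
        using z \<open>z < z'\<close> by (intro bexI[of _ z] insertI2 image_eqI[OF _ z]) simp_all
      moreover have "\<exists>y \<in> insert (Suc t) (snd ` set qs). snd (c, z') \<le> y"
        using \<open>z' < Suc t\<close> by (intro bexI[of _ "Suc t"]) auto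
      ultimately show ?thesis by blast
    next
      case no_col: False
      have "switch (Suc t) D (r, c') = Some (Num (Suc t))"
        using r c' by (simp add: switch_eq)
      then have "(c', Suc t) \<in> ?S'" by (auto simp: column_points_def)
      moreover have "increasing_chain (ps @ (c', Suc t) # qs)"
      proof (rule increasing_chain_replace[OF chain])
        fix q assume q: "q \<in> set ps"
        then have "fst q \<noteq> c'" using no_col by (metis prod.collapse)
        then show "fst q < fst (c', Suc t) \<and> snd q < snd (c', Suc t)"
          using middle(1)[OF q] c'(1) by auto
      next
        fix q assume "q \<in> set qs"
        then show "fst (c', Suc t) < fst q \<and> snd (c', Suc t) < snd q"
          using middle(2)[of q] c'(1) by auto
      qed
      ultimately show ?thesis by (intro bexI[of _ "(c', Suc t)"]) auto
    qed
  qed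
qed

text \<open>The mirror image of the previous inclusion: now \<open>Suc t\<close> is traced back from
  column \<open>c\<close> to column \<open>c + 1\<close>. If the chain already has a value
  \<open>y\<close> there, then \<open>y\<close> lies below row \<open>r\<close>, and the box to its
  left, which is below the dot in column \<open>c\<close>, has an entry strictly between
  \<open>Suc t\<close> and \<open>y\<close> that can replace \<open>Suc t\<close>.\<close>

lemma chain_lengths_switch_supset:
  assumes D: "dotted_increasing t D"
  shows "chain_lengths {a..b} (column_points (delete_dots (switch (Suc t) D))) \<subseteq>
    chain_lengths {a..b} (column_points (delete_dots D))" (is "chain_lengths _ ?S \<subseteq> chain_lengths _ ?S'")
proof (rule chain_lengths_mono_replace[where i = "Suc t"])
  show "(c, x) \<in> ?S'" if "(c, x) \<in> ?S" "x \<noteq> Suc t" for c x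
    using that by (simp add: column_points_def switch_Num_other)
next
  fix c ps qs
  assume "(c, Suc t) \<in> ?S" and chain: "increasing_chain (ps @ (c, Suc t) # qs)"
    and qs: "set qs \<subseteq> ?S"
  then obtain r where r: "switch (Suc t) D (r, c) = Some (Num (Suc t))"
    by (auto simp: column_points_def)
  note middle = increasing_chain_middle[OF chain]
  show "\<exists>p \<in> ?S'. increasing_chain (ps @ p # qs) \<and>
      (\<exists>y \<in> insert (Suc t) (snd ` set ps). y \<le> snd p) \<and>
      (\<exists>y \<in> insert (Suc t) (snd ` set qs). snd p \<le> y)"
  proof (cases "(c, Suc t) \<in> ?S'")
    case True
    then show ?thesis using chain by (intro bexI[of _ "(c, Suc t)"]) auto
  next
    case False
    then have no: "D (q, c) \<noteq> Some (Num (Suc t))" for q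
      by (auto simp: column_points_def)
    \<comment> \<open>The entry cannot have come from below, because column \<open>c\<close>
      contained no \<open>Suc t\<close> before the exchange.\<close>
    have dot: "D (r, c) = Some Dot" and right: "D (r, Suc c) = Some (Num (Suc t))"
      using r no[of r] no[of "Suc r"] by (auto simp: switch_eq split: if_splits)
    show ?thesis
    proof (cases "\<exists>y. (Suc c, y) \<in> set qs")
      case True
      then obtain y where y: "(Suc c, y) \<in> set qs" by blast
      have "Suc t < y" using middle(2)[OF y] by simp
      then obtain r' where r': "D (r', Suc c) = Some (Num y)"
        using qs y by (auto simp: column_points_def switch_Num_other)
      have "\<not> r' \<le> r"
        using dotted_increasing_rank[OF D r' right] \<open>Suc t < y\<close> r' right
        by (cases "r = r'") auto
      then have "r < r'" by simp
      then obtain e where e: "D (r', c) = Some e"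
        using dotted_increasing_between[OF D dot r', of r' c] by auto
      have rank: "entry_rank t Dot < entry_rank t e" "entry_rank t e < entry_rank t (Num y)"
        using dotted_increasing_rank[OF D dot e] dotted_increasing_rank[OF D e r'] \<open>r < r'\<close>
        by auto
      then obtain y' where y': "e = Num y'" by (cases e) auto
      \<comment> \<open>Comparison with the dot only gives \<open>Suc t\<close> \<le>
        \<open>y'\<close>; equality is excluded by \<open>no\<close>.\<close>
      then have "Suc t < y'" "y' < y"
        using rank no[of r'] e by (auto simp: less_Suc_eq_le dest: le_neq_implies_less)
      have "(c, y') \<in> ?S'"
        using e y' by (auto simp: column_points_def)
      moreover have "increasing_chain (ps @ (c, y') # qs)"
      proof (rule increasing_chain_replace[OF chain])
        fix q assume q: "q \<in> set qs"
        have "increasing_chain qs"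
          using chain by (simp add: increasing_chain_def sorted_wrt_append)
        then show "fst (c, y') < fst q \<and> snd (c, y') < snd q"
          using increasing_chain_comparable[of qs q "(Suc c, y)"] q y middle(2)[OF q] \<open>y' < y\<close>
          by auto
      next
        fix q assume "q \<in> set ps"
        then show "fst q < fst (c, y') \<and> snd q < snd (c, y')"
          using middle(1)[of q] \<open>Suc t < y'\<close> by auto
      qed
      moreover have "\<exists>z \<in> insert (Suc t) (snd ` set ps). z \<le> snd (c, y')"
        using \<open>Suc t < y'\<close> by (intro bexI[of _ "Suc t"]) auto
      moreover have "\<exists>z \<in> insert (Suc t) (snd ` set qs). snd (c, y') \<le> z"
        using y \<open>y' < y\<close> by (intro bexI[of _ y] insertI2 image_eqI[OF _ y]) simp_all
      ultimately show ?thesis by blast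
    next
      case no_col: False
      have "(Suc c, Suc t) \<in> ?S'"
        using right by (auto simp: column_points_def)
      moreover have "increasing_chain (ps @ (Suc c, Suc t) # qs)"
      proof (rule increasing_chain_replace[OF chain])
        fix q assume q: "q \<in> set qs"
        then have "fst q \<noteq> Suc c" using no_col by (metis prod.collapse)
        then show "fst (Suc c, Suc t) < fst q \<and> snd (Suc c, Suc t) < snd q"
          using middle(2)[OF q] by auto
      next
        fix q assume "q \<in> set ps"
        then show "fst q < fst (Suc c, Suc t) \<and> snd q < snd (Suc c, Suc t)"
          using middle(1)[of q]  by auto
      qed
      ultimately show ?thesis by (intro bexI[of _ "(Suc c, Suc t)"]) auto
    qed
  qed
qed

lemma chain_lengths_switch:
  assumes "dotted_increasing t D"
  shows "chain_lengths {a..b} (column_points (delete_dots (switch (Suc t) D))) =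
    chain_lengths {a..b} (column_points (delete_dots D))"
  using chain_lengths_switch_subset[OF assms] chain_lengths_switch_supset[OF assms] by blast


section \<open>Slides into an antidiagonal\<close>

text \<open>The last conclusion serves to bound the entries at the end of a slide, so that the
  remaining dots, whose rank is then 2m+1, can be compared with them.\<close>

lemma fold_switch:
  assumes "dotted_increasing 0 D"
  shows "dotted_increasing m (fold switch [1..<Suc m] D)"
    and "dom (fold switch [1..<Suc m] D) = dom D"
    and "chain_lengths {a..b} (column_points (delete_dots (fold switch [1..<Suc m] D))) =
      chain_lengths {a..b} (column_points (delete_dots D))"
    and "fold switch [1..<Suc m] D p = Some (Num x) \<Longrightarrow> 1 \<le> x \<and> x \<le> m \<or> (\<exists>q. D q = Some (Num x))"
proof (induction m arbitrary: p x)
  case (Suc m)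
  let ?D = "fold switch [1..<Suc m] D"
  have step: "fold switch [1..<Suc (Suc m)] D = switch (Suc m) ?D"
    by simp
  {
    case 1
    show ?case unfolding step by (rule dotted_increasing_switch) (rule Suc(1))
  next
    case 2
    show ?case unfolding step using Suc(2) by simp
  next
    case 3
    show ?case unfolding step using chain_lengths_switch[OF Suc(1)] Suc(3) by simp
  next
    case 4
    then have "x = Suc m \<or> ?D p = Some (Num x)"
      using switch_Num_other[of x "Suc m" ?D p] unfolding step by blast
    then show ?case using Suc(4)[of p x] by auto
  }
qed (use assms in auto)

text \<open>These are the inner corners of \<open>staircase k\<close>, and for \<open>k\<close>
  \<ge> 1 the boxes in which a minimal tableau can have the entry \<open>k\<close>.\<close>

definition antidiagonal :: "nat \<Rightarrow> box set" where
  "antidiagonal k = {(r, c). 1 \<le> r \<and> 1 \<le> c \<and> r + c = Suc k}"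

text \<open>The tableaux of skew shape \<open>mu / staircase k\<close>: a box with positive coordinates lies
  outside the staircase iff the sum of its coordinates is at least \<open>k + 2\<close>.\<close>

definition staircase_skew :: "nat \<Rightarrow> tableau \<Rightarrow> bool" where
  "staircase_skew k T \<longleftrightarrow> finite (dom T) \<and> (\<forall>x \<in> ran T. 0 < x) \<and>
     (\<forall>(r, c) \<in> dom T. 1 \<le> r \<and> 1 \<le> c \<and> k + 2 \<le> r + c) \<and>
     (\<forall>r c r' c'. (r', c') \<in> dom T \<longrightarrow> 1 \<le> r \<longrightarrow> 1 \<le> c \<longrightarrow> k + 2 \<le> r + c \<longrightarrow>
        r \<le> r' \<longrightarrow> c \<le> c' \<longrightarrow> (r, c) \<in> dom T) \<and>
     (\<forall>r c r' c' x x'. T (r, c) = Some x \<longrightarrow> T (r', c') = Some x' \<longrightarrow>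
        r \<le> r' \<longrightarrow> c \<le> c' \<longrightarrow> (r, c) \<noteq> (r', c') \<longrightarrow> x < x')"

lemma staircase_skewD:
  assumes "staircase_skew k T"
  shows "finite (dom T)"
    and "T b = Some x \<Longrightarrow> 0 < x"
    and "(r, c) \<in> dom T \<Longrightarrow> 1 \<le> r \<and> 1 \<le> c \<and> k + 2 \<le> r + c"
    and "(r', c') \<in> dom T \<Longrightarrow> 1 \<le> r \<Longrightarrow> 1 \<le> c \<Longrightarrow> k + 2 \<le> r + c \<Longrightarrow>
      r \<le> r' \<Longrightarrow> c \<le> c' \<Longrightarrow> (r, c) \<in> dom T"
    and "T (r, c) = Some x \<Longrightarrow> T (r', c') = Some x' \<Longrightarrow>
      r \<le> r' \<Longrightarrow> c \<le> c' \<Longrightarrow> (r, c) \<noteq> (r', c') \<Longrightarrow> x < x'"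
proof -
  note T = assms[unfolded staircase_skew_def]
  note T1 = T[THEN conjunct1] and T' = T[THEN conjunct2]
  note T2 = T'[THEN conjunct1] and T'' = T'[THEN conjunct2]
  note T3 = T''[THEN conjunct1] and T''' = T''[THEN conjunct2]
  show "finite (dom T)" by (rule T1)
  show "T b = Some x \<Longrightarrow> 0 < x" using T2 by (blast intro: ranI)
  show "(r, c) \<in> dom T \<Longrightarrow> 1 \<le> r \<and> 1 \<le> c \<and> k + 2 \<le> r + c" using T3 by blast
  show "(r', c') \<in> dom T \<Longrightarrow> 1 \<le> r \<Longrightarrow> 1 \<le> c \<Longrightarrow> k + 2 \<le> r + c \<Longrightarrow>
      r \<le> r' \<Longrightarrow> c \<le> c' \<Longrightarrow> (r, c) \<in> dom T"
    using T'''[THEN conjunct1, rule_format] .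
  show "T (r, c) = Some x \<Longrightarrow> T (r', c') = Some x' \<Longrightarrow>
      r \<le> r' \<Longrightarrow> c \<le> c' \<Longrightarrow> (r, c) \<noteq> (r', c') \<Longrightarrow> x < x'"
    using T'''[THEN conjunct2, rule_format] .
qed

section \<open>One slide, from \<open>staircase (Suc k)\<close> to
  \<open>staircase k\<close>\<close>

context
  fixes k T
  assumes T: "staircase_skew (Suc k) T"
begin

lemma antidiagonal_disjoint:
  assumes "b \<in> antidiagonal (Suc k)"
  shows "T b = None"
proof (rule ccontr)
  obtain r c where b: "b = (r, c)" by (cases b)
  assume "T b \<noteq> None"
  then have "Suc k + 2 \<le> r + c"
    using staircase_skewD(3)[OF T] unfolding b domIff by blast
  then show False
    using assms unfolding b by (simp add: antidiagonal_def)
qed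

lemma delete_place_dots: "delete_dots (place_dots (antidiagonal (Suc k)) T) = T"
  by (rule ext) (auto simp: delete_dots_def place_dots_def antidiagonal_disjoint split: option.split)

lemma dom_place_dots: "dom (place_dots (antidiagonal (Suc k)) T) = antidiagonal (Suc k) \<union> dom T"
  by (auto simp: place_dots_def split: if_splits)

lemma place_dots_range:
  "(r, c) \<in> dom (place_dots (antidiagonal (Suc k)) T) \<Longrightarrow> 1 \<le> r \<and> 1 \<le> c \<and> k + 2 \<le> r + c"
  unfolding dom_place_dots
proof (elim UnE)
  show "(r, c) \<in> dom T \<Longrightarrow> 1 \<le> r \<and> 1 \<le> c \<and> k + 2 \<le> r + c"
    using staircase_skewD(3)[OF T, of r c] by linarith
qed (simp add: antidiagonal_def)

lemma place_dots_down_closed: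
  assumes dom: "(r', c') \<in> dom (place_dots (antidiagonal (Suc k)) T)"
    and rc: "1 \<le> r" "1 \<le> c" "k + 2 \<le> r + c" "r \<le> r'" "c \<le> c'"
  shows "(r, c) \<in> dom (place_dots (antidiagonal (Suc k)) T)"
proof (cases "r + c = k + 2")
  case True
  then show ?thesis using rc(1,2) unfolding dom_place_dots by (simp add: antidiagonal_def)
next
  case False
  then have "r' + c' \<noteq> k + 2" using rc by simp
  then have "(r', c') \<in> dom T" using dom unfolding dom_place_dots by (simp add: antidiagonal_def)
  then show ?thesis
    using staircase_skewD(4)[OF T, of r' c' r c] rc False unfolding dom_place_dots by simp
qed

text \<open>At stage 0 a dot has rank 1, below the rank of any positive entry. The dots occupy the
  boxes of smallest coordinate sum, so nothing lies strictly northwest of a dot.\<close>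

lemma dotted_increasing_place_dots: "dotted_increasing 0 (place_dots (antidiagonal (Suc k)) T)"
  unfolding dotted_increasing_def
proof (intro conjI allI impI)
  show "convex_boxes (dom (place_dots (antidiagonal (Suc k)) T))"
    unfolding convex_boxes_def
  proof (intro allI impI)
    fix r c r' c' r'' c''
    assume rc: "(r, c) \<in> dom (place_dots (antidiagonal (Suc k)) T)"
      and dom: "(r'', c'') \<in> dom (place_dots (antidiagonal (Suc k)) T)"
      and le: "r \<le> r'" "r' \<le> r''" "c \<le> c'" "c' \<le> c''"
    show "(r', c') \<in> dom (place_dots (antidiagonal (Suc k)) T)"
      using place_dots_down_closed[OF dom, of r' c'] place_dots_range[OF rc] le by simp
  qed
next
  fix r c r' c' e e'
  assume e: "place_dots (antidiagonal (Suc k)) T (r, c) = Some e"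
    and e': "place_dots (antidiagonal (Suc k)) T (r', c') = Some e'"
    and le: "r \<le> r'" "c \<le> c'" and ne: "(r, c) \<noteq> (r', c')"
  have "k + 2 \<le> r + c" using place_dots_range e by blast
  then have "(r', c') \<notin> antidiagonal (Suc k)"
    using le ne by (auto simp: antidiagonal_def)
  then obtain x' where x': "T (r', c') = Some x'" "e' = Num x'"
    using e' by (auto simp: place_dots_def)
  show "entry_rank 0 e < entry_rank 0 e'"
  proof (cases "(r, c) \<in> antidiagonal (Suc k)")
    case True
    then show ?thesis
      using e staircase_skewD(2)[OF T x'(1)] x'(2) by (auto simp: place_dots_def)
  next
    case False
    then obtain x where x: "T (r, c) = Some x" "e = Num x"
      using e by (auto simp: place_dots_def)
    show ?thesis
      using staircase_skewD(5)[OF T x(1) x'(1) le ne] x(2) x'(2) by simp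
  qed
qed

lemma chain_lengths_jdt_set:
  "chain_lengths {a..b} (column_points (jdt_set (antidiagonal (Suc k)) T)) =
    chain_lengths {a..b} (column_points T)"
  unfolding jdt_set_def fold_switch(3)[OF dotted_increasing_place_dots] delete_place_dots ..

text \<open>Once all entries up to the maximum \<open>m\<close> are processed, a dot outranks every
  entry. So no dot is weakly northwest of an entry, and deleting the dots leaves no hole in the
  shape.\<close>

lemma staircase_skew_jdt_set: "staircase_skew k (jdt_set (antidiagonal (Suc k)) T)"
proof -
  let ?P = "place_dots (antidiagonal (Suc k)) T"
  define m where "m = largest_entry T"
  define D where "D = fold switch [1..<Suc m] ?P"
  note fold = fold_switch[OF dotted_increasing_place_dots, where m = m, folded D_def]
  have fin: "finite (dom T)" using staircase_skewD(1)[OF T] .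
  then have "finite (ran T)"
    by (rule finite_ran)
  then have T_le: "x \<le> m" if "T b = Some x" for b x
    unfolding m_def largest_entry_def
    using \<open>finite (ran T)\<close> that by (intro Max_ge) (simp_all add: ranI)
  have entry: "1 \<le> x \<and> x \<le> m" if x: "D b = Some (Num x)" for b x
  proof -
    have "1 \<le> x \<and> x \<le> m \<or> (\<exists>q. T q = Some x)"
      using fold(4)[OF x] unfolding delete_dots_eq_Some[symmetric] delete_place_dots .
    then show ?thesis
    proof (elim disjE exE)
      fix q assume "T q = Some x"
      then show ?thesis using T_le staircase_skewD(2)[OF T] by (simp add: Suc_le_eq)
    qed
  qed
  have jdt: "jdt_set (antidiagonal (Suc k)) T = delete_dots D"
    by (simp add: jdt_set_def D_def m_def)
  have sub: "dom (delete_dots D) \<subseteq> dom D" by auto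
  have "finite (antidiagonal (Suc k))"
    by (rule finite_subset[of _ "{..k + 2} \<times> {..k + 2}"]) (auto simp: antidiagonal_def)
  then have "finite (dom D)"
    using fin unfolding fold(2) dom_place_dots by simp
  then have "finite (dom (delete_dots D))"
    using sub by (rule finite_subset[rotated])
  moreover have "\<forall>x \<in> ran (delete_dots D). 0 < x"
  proof
    fix x assume "x \<in> ran (delete_dots D)"
    then obtain b where "D b = Some (Num x)" unfolding ran_def delete_dots_eq_Some by blast
    then show "0 < x" using entry[of b x] by simp
  qed
  moreover have "\<forall>(r, c) \<in> dom (delete_dots D). 1 \<le> r \<and> 1 \<le> c \<and> k + 2 \<le> r + c"
    using place_dots_range sub unfolding fold(2) by blast
  moreover have "\<forall>r c r' c'. (r', c') \<in> dom (delete_dots D) \<longrightarrow> 1 \<le> r \<longrightarrow> 1 \<le> c \<longrightarrow> k + 2 \<le> r + c \<longrightarrow>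
      r \<le> r' \<longrightarrow> c \<le> c' \<longrightarrow> (r, c) \<in> dom (delete_dots D)"
  proof (intro allI impI)
    fix r c r' c'
    assume dom: "(r', c') \<in> dom (delete_dots D)"
      and rc: "1 \<le> r" "1 \<le> c" "k + 2 \<le> r + c" "r \<le> r'" "c \<le> c'"
    obtain x where x: "D (r', c') = Some (Num x)" using dom by auto
    have "(r, c) \<in> dom D"
      using place_dots_down_closed[OF _ rc] x unfolding fold(2)[symmetric] by blast
    then obtain e where e: "D (r, c) = Some e" by blast
    have "e \<noteq> Dot"
    proof
      assume "e = Dot"
      then have "(r, c) \<noteq> (r', c')" using x e by auto
      from dotted_increasing_rank[OF fold(1) e x rc(4,5) this] show False
        using entry[OF x] \<open>e = Dot\<close> by simp
    qed
    then obtain y where "e = Num y" by (cases e) auto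
    then show "(r, c) \<in> dom (delete_dots D)" using e by auto
  qed
  moreover have "\<forall>r c r' c' x x'. delete_dots D (r, c) = Some x \<longrightarrow> delete_dots D (r', c') = Some x' \<longrightarrow>
      r \<le> r' \<longrightarrow> c \<le> c' \<longrightarrow> (r, c) \<noteq> (r', c') \<longrightarrow> x < x'"
  proof (intro allI impI)
    fix r c r' c' x x'
    assume "delete_dots D (r, c) = Some x" "delete_dots D (r', c') = Some x'"
    then have x: "D (r, c) = Some (Num x)" "D (r', c') = Some (Num x')"
      by simp_all
    assume le: "r \<le> r'" "c \<le> c'" "(r, c) \<noteq> (r', c')"
    show "x < x'"
      using dotted_increasing_rank[OF fold(1) x le] by simp
  qed
  ultimately show ?thesis
    unfolding jdt staircase_skew_def by (intro conjI)
qed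

end

lemma chain_lengths_fold_jdt_set:
  assumes "staircase_skew k U"
  shows "chain_lengths {a..b} (column_points (fold (\<lambda>i. jdt_set (antidiagonal i)) (rev [1..<Suc k]) U)) =
    chain_lengths {a..b} (column_points U)"
  using assms
proof (induction k arbitrary: U)
  case (Suc k)
  then show ?case
    using Suc.IH[OF staircase_skew_jdt_set[OF Suc.prems]] chain_lengths_jdt_set[OF Suc.prems] by simp
qed simp

section \<open>The minimal tableau as a sequence of antidiagonals\<close>

lemma minimal_tableau_eq_Some:
  "minimal_tableau k b = Some i \<longleftrightarrow> 1 \<le> i \<and> i \<le> k \<and> b \<in> antidiagonal i"
  by (cases b) (auto simp: minimal_tableau_def staircase_def antidiagonal_def)

lemma largest_entry_minimal_tableau: "largest_entry (minimal_tableau k) = k"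
proof -
  have "(i, 1) \<in> antidiagonal i" if "1 \<le> i" for i
    using that by (simp add: antidiagonal_def)
  then have ran: "ran (minimal_tableau k) = {1..k}"
    unfolding ran_def minimal_tableau_eq_Some atLeastAtMost_def by blast
  \<comment> \<open>For \<open>k = 0\<close> the tableau is empty and the inserted 0 provides the
    value.\<close>
  have "Max (insert 0 {1..k}) = k"
    by (cases "k = 0") (auto intro: Max_eqI)
  then show ?thesis unfolding largest_entry_def ran .
qed

lemma jdt_minimal_tableau:
  "jdt_tableau (minimal_tableau k) U = fold (\<lambda>i. jdt_set (antidiagonal i)) (rev [1..<Suc k]) U"
  unfolding jdt_tableau_def largest_entry_minimal_tableau
proof (rule fold_cong)
  fix i assume "i \<in> set (rev [1..<Suc k])"
  then have "{b. minimal_tableau k b = Some i} = antidiagonal i"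
    by (auto simp: minimal_tableau_eq_Some)
  then show "jdt_set {b. minimal_tableau k b = Some i} = jdt_set (antidiagonal i)"
    by simp
qed simp_all

section \<open>Words\<close>

lemma word_tableau_eq_Some:
  assumes "w \<noteq> []"
  shows "word_tableau w (r, c) = Some x \<longleftrightarrow>
    1 \<le> r \<and> 1 \<le> c \<and> r + c = Suc (length w) \<and> x = w ! (c - 1)"
proof -
  have "0 < length w" using assms by simp
  then show ?thesis by (auto simp: word_tableau_def staircase_def)
qed

text \<open>Distinct boxes of one antidiagonal are incomparable, so an arbitrary word satisfies the
  monotonicity condition vacuously.\<close>

lemma staircase_skew_word_tableau:
  assumes "w \<noteq> []" and "\<forall>x \<in> set w. 0 < x"
  shows "staircase_skew (length w - 1) (word_tableau w)"
proof -
  note eq = word_tableau_eq_Some[OF assms(1)]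
  have dom: "dom (word_tableau w) = {(r, c). 1 \<le> r \<and> 1 \<le> c \<and> r + c = Suc (length w)}"
    by (auto simp: dom_def eq)
  have "finite (dom (word_tableau w))"
    by (rule finite_subset[of _ "{..Suc (length w)} \<times> {..Suc (length w)}"]) (auto simp: dom)
  moreover have "\<forall>x \<in> ran (word_tableau w). 0 < x"
    using assms(2) by (auto simp: ran_def eq)
  ultimately show ?thesis
    using assms(1) unfolding staircase_skew_def
    by (intro conjI) (auto simp: dom eq)
qed

lemma column_points_word_tableau:
  assumes "w \<noteq> []"
  shows "column_points (word_tableau w) = {(c, x). 1 \<le> c \<and> c \<le> length w \<and> x = w ! (c - 1)}"
proof -
  have "(\<exists>r. 1 \<le> r \<and> 1 \<le> c \<and> r + c = Suc (length w) \<and> x = w ! (c - 1)) \<longleftrightarrow>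
      1 \<le> c \<and> c \<le> length w \<and> x = w ! (c - 1)" for c x
    by (auto intro!: exI[of _ "Suc (length w) - c"])
  then show ?thesis
    by (simp add: column_points_def word_tableau_eq_Some[OF assms])
qed

text \<open>A chain in the graph of a word is a choice of positions, whereas \<open>subseq\<close>
  only retains letters. Both directions therefore pass through a strictly increasing list
  \<open>js\<close> of positions, counted from 0, while columns are counted from 1.\<close>

lemma chain_lengths_word:
  "chain_lengths A {(c, x). 1 \<le> c \<and> c \<le> length w \<and> x = w ! (c - 1)} =
    {length s | s. subseq s (filter (\<lambda>x. int x \<in> A) w) \<and> sorted_wrt (<) s}" (is "?L = ?R")
proof (intro equalityI subsetI)
  fix k assume "k \<in> ?L"
  then obtain ps where ps: "k = length ps" "increasing_chain ps"
    and points: "\<forall>(c, x) \<in> set ps. 1 \<le> c \<and> c \<le> length w \<and> x = w ! (c - 1)"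
    and A: "\<forall>(c, x) \<in> set ps. int x \<in> A"
    unfolding chain_lengths_def by blast
  have points': "p \<in> set ps \<Longrightarrow> 1 \<le> fst p \<and> fst p \<le> length w \<and> snd p = w ! (fst p - 1)" for p
    using points by (cases p) auto
  define js where "js = map (\<lambda>p. fst p - 1) ps"
  have "sorted_wrt (\<lambda>p q. fst p - 1 < fst q - 1) ps"
  proof (rule sorted_wrt_mono_rel[OF _ ps(2)[unfolded increasing_chain_def]])
    fix p q assume "p \<in> set ps" "fst p < fst q \<and> snd p < snd q"
    then show "fst p - 1 < fst q - 1" using points'[of p] by (simp add: diff_less_mono)
  qed
  moreover have "sorted_wrt (\<lambda>p q. snd p < snd q) ps"
    by (rule sorted_wrt_mono_rel[OF _ ps(2)[unfolded increasing_chain_def]]) blast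
  ultimately have "sorted_wrt (<) js" and sorted: "sorted_wrt (<) (map snd ps)"
    by (simp_all add: js_def sorted_wrt_map)
  moreover have "set js \<subseteq> set [0..<length w]"
  proof
    fix j assume "j \<in> set js"
    then obtain p where "p \<in> set ps" "j = fst p - 1" unfolding js_def by auto
    then show "j \<in> set [0..<length w]" using points'[of p] by auto
  qed
  ultimately have "subseq js [0..<length w]"
    by (intro sorted_subset_imp_subseq) auto
  then have "subseq (map ((!) w) js) (map ((!) w) [0..<length w])"
    by (rule subseq_map)
  moreover have "map ((!) w) js = map snd ps"
    using points' by (simp add: js_def)
  ultimately have "subseq (map snd ps) w" by (simp add: map_nth)
  then have "subseq (filter (\<lambda>x. int x \<in> A) (map snd ps)) (filter (\<lambda>x. int x \<in> A) w)"
    by (rule subseq_filter)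
  moreover have "filter (\<lambda>x. int x \<in> A) (map snd ps) = map snd ps"
    unfolding filter_id_conv using A by (simp add: case_prod_unfold)
  moreover have "k = length (map snd ps)"
    using ps(1) by simp
  ultimately show "k \<in> ?R"
    using sorted unfolding mem_Collect_eq by metis
next
  fix k assume "k \<in> ?R"
  then obtain s where s: "k = length s" "subseq s (filter (\<lambda>x. int x \<in> A) w)" "sorted_wrt (<) s"
    by blast
  have "set s \<subseteq> set (filter (\<lambda>x. int x \<in> A) w)"
    using s(2) unfolding subseq_conv_nths by (elim exE) (simp only: set_nths_subset)
  then have A: "\<forall>x \<in> set s. int x \<in> A"
    by auto
  have "subseq s w"
    by (rule subseq_order.order_trans[OF s(2) subseq_filter_left])
  \<comment> \<open>Writing \<open>w\<close> as the image of its list of positions lets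
    \<open>nths\<close> recover the positions of the chosen letters.\<close>
  then obtain N where "s = nths (map ((!) w) [0..<length w]) N"
    unfolding subseq_conv_nths map_nth by blast
  then obtain js where js: "s = map ((!) w) js" "js = nths [0..<length w] N"
    by (simp add: nths_map)
  have "sorted_wrt (<) js"
    unfolding js(2) strict_sorted_iff by (simp add: sorted_nths)
  define ps where "ps = map (\<lambda>j. (Suc j, w ! j)) js"
  have "increasing_chain ps"
    using s(3) \<open>sorted_wrt (<) js\<close> unfolding increasing_chain_def ps_def js(1)
    by (simp add: sorted_wrt_iff_nth_less)
  moreover have "set ps \<subseteq> {(c, x). 1 \<le> c \<and> c \<le> length w \<and> x = w ! (c - 1)}"
    using set_nths_subset[of "[0..<length w]" N] by (auto simp: ps_def js(2))
  moreover have "\<forall>(c, x) \<in> set ps. int x \<in> A"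
    using A by (auto simp: ps_def js(1))
  moreover have "k = length ps"
    by (simp add: ps_def s(1) js(1))
  ultimately show "k \<in> ?L"
    unfolding chain_lengths_def by blast
qed

text \<open>The right-hand side involves \<open>w\<close> only through its rectification, so equal
  rectifications yield equal values for every interval.\<close>

lemma lis_filter_eq:
  assumes "w \<noteq> []" and "\<forall>x \<in> set w. 0 < x"
  shows "lis (filter (\<lambda>x. int x \<in> {a..b}) w) = Max (chain_lengths {a..b} (column_points (rect_word w)))"
  unfolding lis_def rect_word_def jdt_minimal_tableau
    chain_lengths_fold_jdt_set[OF staircase_skew_word_tableau[OF assms]]
    column_points_word_tableau[OF assms(1)] chain_lengths_word ..

section \<open>Transposition\<close>

text \<open>\<open>prod.swap\<close> reflects in the main diagonal, which interchanges
  \<open>below\<close> and \<open>right_of\<close>; an exchange treats the two alike.\<close>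

lemma switch_swap: "switch i (D \<circ> prod.swap) = switch i D \<circ> prod.swap"
proof
  fix b :: box
  show "switch i (D \<circ> prod.swap) b = (switch i D \<circ> prod.swap) b"
    by (cases b) (auto simp: switch_eq)
qed

lemma fold_switch_swap: "fold switch is (D \<circ> prod.swap) = fold switch is D \<circ> prod.swap"
  by (induction "is" arbitrary: D) (simp_all add: switch_swap)

lemma swap_antidiagonal [simp]: "prod.swap b \<in> antidiagonal k \<longleftrightarrow> b \<in> antidiagonal k"
  by (cases b) (auto simp: antidiagonal_def)

lemma ran_swap: "ran (T \<circ> prod.swap) = ran T"
  unfolding ran_def by (auto simp: split_paired_Ex)

lemma jdt_set_swap:
  "jdt_set (antidiagonal k) (T \<circ> prod.swap) = jdt_set (antidiagonal k) T \<circ> prod.swap"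
proof -
  have "place_dots (antidiagonal k) (T \<circ> prod.swap) = place_dots (antidiagonal k) T \<circ> prod.swap"
    by (rule ext) (simp add: place_dots_def)
  moreover have "delete_dots (D \<circ> prod.swap) = delete_dots D \<circ> prod.swap" for D
    by (rule ext) (simp add: delete_dots_def)
  ultimately show ?thesis
    by (simp only: jdt_set_def largest_entry_def ran_swap fold_switch_swap)
qed

text \<open>Every antidiagonal is mapped to itself by the reflection, so each slide of the sequence
  commutes with it.\<close>

lemma jdt_minimal_tableau_swap:
  "jdt_tableau (minimal_tableau k) (U \<circ> prod.swap) = jdt_tableau (minimal_tableau k) U \<circ> prod.swap"
proof -
  have "fold (\<lambda>i. jdt_set (antidiagonal i)) is (U \<circ> prod.swap) =
      fold (\<lambda>i. jdt_set (antidiagonal i)) is U \<circ> prod.swap" for "is"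
    by (induction "is" arbitrary: U) (simp_all add: jdt_set_swap)
  then show ?thesis unfolding jdt_minimal_tableau .
qed

text \<open>On the antidiagonal the reflection sends column \<open>c\<close> to column
  \<open>length w + 1 - c\<close>, and the column alone determines which letter is placed.\<close>

lemma word_tableau_rev:
  assumes "w \<noteq> []"
  shows "word_tableau (rev w) = word_tableau w \<circ> prod.swap"
proof
  fix b :: box
  obtain r c where b: "b = (r, c)" by (cases b)
  have "rev w \<noteq> []" using assms by simp
  have "rev w ! (c - 1) = w ! (r - 1)" if "1 \<le> r" "1 \<le> c" "r + c = Suc (length w)"
  proof -
    have "c - 1 < length w" "length w - Suc (c - 1) = r - 1" using that by auto
    then show ?thesis by (simp add: rev_nth)
  qed
  then have "word_tableau (rev w) (r, c) = Some x \<longleftrightarrow> word_tableau w (c, r) = Some x" for x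
    unfolding word_tableau_eq_Some[OF assms] word_tableau_eq_Some[OF \<open>rev w \<noteq> []\<close>] by auto
  then show "word_tableau (rev w) b = (word_tableau w \<circ> prod.swap) b"
    unfolding b by (cases "word_tableau w (c, r)"; cases "word_tableau (rev w) (r, c)") auto
qed

lemma rect_word_rev: "w \<noteq> [] \<Longrightarrow> rect_word (rev w) = rect_word w \<circ> prod.swap"
  by (simp add: rect_word_def word_tableau_rev jdt_minimal_tableau_swap)

section \<open>Decreasing subsequences by reversal\<close>

lemma subseq_rev: "subseq s x \<Longrightarrow> subseq (rev s) (rev x)"
  by (induction rule: list_emb.induct) (auto intro: subseq_rev_drop_many list_emb_append_mono)

lemma lds_eq_lis_rev: "lds x = lis (rev x)"
proof -
  have "{length s | s. subseq s x \<and> sorted_wrt (>) s} = {length s | s. subseq s (rev x) \<and> sorted_wrt (<) s}"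
  proof (intro equalityI subsetI; clarify)
    fix s assume "subseq s x" "sorted_wrt (>) s"
    then show "\<exists>s'. length s = length s' \<and> subseq s' (rev x) \<and> sorted_wrt (<) s'"
      by (intro exI[of _ "rev s"]) (simp add: subseq_rev sorted_wrt_rev)
  next
    fix s assume "subseq s (rev x)" "sorted_wrt (<) s"
    then show "\<exists>s'. length s = length s' \<and> subseq s' x \<and> sorted_wrt (>) s'"
      using subseq_rev[of s "rev x"] by (intro exI[of _ "rev s"]) (simp add: sorted_wrt_rev)
  qed
  then show ?thesis by (simp add: lds_def lis_def)
qed

theorem theorem2p13:
  fixes n :: nat and u w :: "nat list"
  assumes "n \<ge> 1" and "u \<in> words n" and "w \<in> words n"
    and "rect_word u = rect_word w"
  shows "u \<sim>\<^sub>r\<^sub>i\<^sub>d w"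
proof -
  have u: "u \<noteq> []" "\<forall>x \<in> set u. 0 < x" and w: "w \<noteq> []" "\<forall>x \<in> set w. 0 < x"
    using assms(1-3) by (auto simp: words_def)
  have rev: "rev u \<noteq> []" "\<forall>x \<in> set (rev u). 0 < x" "rev w \<noteq> []" "\<forall>x \<in> set (rev w). 0 < x"
    using u w by simp_all
  have "rect_word (rev u) = rect_word (rev w)"
    using assms(4) u(1) w(1) by (simp add: rect_word_rev)
  then show ?thesis
    \<comment> \<open>Restriction to an interval commutes with reversal by
      \<open>rev_filter\<close>, so \<open>lds\<close> of a restricted word becomes
      \<open>lis\<close> of the restricted reversed word.\<close>
    unfolding rid_equiv_def Let_def lds_eq_lis_rev rev_filter
      lis_filter_eq[OF u] lis_filter_eq[OF w] lis_filter_eq[OF rev(1,2)] lis_filter_eq[OF rev(3,4)]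
    using assms(4) by simp
qed

end
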